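(* Let $N$ be a set, let $n$ be a natural number, and let $\overline{X}=(X_1,\dots,X_n)$ and $\overline{Y}=(Y_1,\dots,Y_n)$ be $n$-tuples of nonempty subsets of $N$. Then $$\overline{X}\approx\overline{Y}\quad\Longleftrightarrow\quad \text{there exists } \sigma\in S_n \text{ such that } \sigma\cdot\overline{X}=\overline{Y}.$$
   Context: $S_n$ is the symmetric group on $\{1,\dots,n\}$; it acts on $n$-tuples by $\sigma\cdot(a_1,\dots,a_n)=(a_{\sigma^{-1}(1)},\dots,a_{\sigma^{-1}(n)})$. An $n$-multiset of elements of $N$ is an orbit of this action on $N^n$. For an $n$-tuple $\overline{X}=(X_1,\dots,X_n)$ of nonempty subsets of $N$, the set $\mathcal{S}(\overline{X})$ of (unordered) sections of $\overline{X}$ is the set of all $n$-multisets that are orbits of tuples $(a_1,\dots,a_n)\in\prod_{1\le i\le n}X_i$. For two $n$-tuples of nonempty subsets of $N$, $\overline{X}\sqsubseteq\overline{Y}$ means $\mathcal{S}(\overline{X})\subseteq\mathcal{S}(\overline{Y})$, and $\overline{X}\approx\overline{Y}$ means $\overline{X}\sqsubseteq\overline{Y}$ and $\overline{Y}\sqsubseteq\overline{X}$, i.e. $\mathcal{S}(\overline{X})=\mathcal{S}(\overline{Y})$. *)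

theory Defs
  imports "HOL-Algebra.Group_Action" "HOL-Algebra.Sym_Groups"
begin

text \<open>
  An \<open>n\<close>-tuple of elements of \<open>A\<close> is an element of \<open>{1..n} \<rightarrow>\<^sub>E A\<close>: a function on
  \<open>{1..n}\<close>, with the value \<open>undefined\<close> at every other index, so that equality of functions is
  equality of tuples.
\<close>

definition perm_tuple :: "nat \<Rightarrow> (nat \<Rightarrow> nat) \<Rightarrow> (nat \<Rightarrow> 'b) \<Rightarrow> nat \<Rightarrow> 'b"
  where "perm_tuple n \<sigma> a = (\<lambda>i\<in>{1..n}. a (inv' \<sigma> i))"

definition n_multisets :: "nat \<Rightarrow> 'a set \<Rightarrow> (nat \<Rightarrow> 'a) set set"
  where "n_multisets n N = orbits (sym_group n) ({1..n} \<rightarrow>\<^sub>E N) (perm_tuple n)"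

definition nonempty_subset_tuples :: "nat \<Rightarrow> 'a set \<Rightarrow> (nat \<Rightarrow> 'a set) set"
  where "nonempty_subset_tuples n N = ({1..n} \<rightarrow>\<^sub>E (Pow N - {{}}))"

definition sections :: "nat \<Rightarrow> 'a set \<Rightarrow> (nat \<Rightarrow> 'a set) \<Rightarrow> (nat \<Rightarrow> 'a) set set"
  where "sections n N X =
    {M \<in> n_multisets n N. \<exists>a \<in> (\<Pi>\<^sub>E i\<in>{1..n}. X i). M = orbit (sym_group n) (perm_tuple n) a}"

definition sections_le :: "nat \<Rightarrow> 'a set \<Rightarrow> (nat \<Rightarrow> 'a set) \<Rightarrow> (nat \<Rightarrow> 'a set) \<Rightarrow> bool"
  where "sections_le n N X Y \<longleftrightarrow> sections n N X \<subseteq> sections n N Y"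

definition sections_equiv :: "nat \<Rightarrow> 'a set \<Rightarrow> (nat \<Rightarrow> 'a set) \<Rightarrow> (nat \<Rightarrow> 'a set) \<Rightarrow> bool"
  where "sections_equiv n N X Y \<longleftrightarrow> sections_le n N X Y \<and> sections_le n N Y X"

text \<open>
  The library's locale \<open>group_action\<close> asks for maps that are extensional on the set acted upon;
  \<open>perm_tuple n \<sigma>\<close> is not, since it acts on tuples over any set. \<open>orbit\<close> and \<open>orbits\<close>
  need no such restriction; the laws of an action are the following.
\<close>

lemma perm_tuple_closed:
  assumes "\<sigma> \<in> carrier (sym_group n)" "a \<in> {1..n} \<rightarrow>\<^sub>E A"
  shows "perm_tuple n \<sigma> a \<in> {1..n} \<rightarrow>\<^sub>E A"
proof -
  have "inv' \<sigma> permutes {1..n}"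
    using assms(1) by (simp add: sym_group_carrier permutes_inv)
  then have "inv' \<sigma> i \<in> {1..n}" if "i \<in> {1..n}" for i
    using that permutes_in_image by fastforce
  then show ?thesis
    using assms(2) by (auto simp: perm_tuple_def)
qed

lemma perm_tuple_one:
  assumes "a \<in> {1..n} \<rightarrow>\<^sub>E A"
  shows "perm_tuple n \<one>\<^bsub>sym_group n\<^esub> a = a"
  using assms by (auto simp: perm_tuple_def sym_group_one fun_eq_iff PiE_def extensional_def)

lemma perm_tuple_mult:
  assumes "\<sigma> \<in> carrier (sym_group n)" "\<tau> \<in> carrier (sym_group n)"
  shows "perm_tuple n (\<sigma> \<otimes>\<^bsub>sym_group n\<^esub> \<tau>) a = perm_tuple n \<sigma> (perm_tuple n \<tau> a)"
proof -
  have perm: "\<sigma> permutes {1..n}" "\<tau> permutes {1..n}"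
    using assms by (simp_all add: sym_group_carrier)
  have "inv' \<sigma> i \<in> {1..n}" if "i \<in> {1..n}" for i
    using that permutes_in_image[OF permutes_inv[OF perm(1)]] by blast
  moreover have "inv' (\<sigma> \<circ> \<tau>) = inv' \<tau> \<circ> inv' \<sigma>"
    using perm by (simp add: o_inv_distrib permutes_bij)
  ultimately show ?thesis
    by (auto simp: perm_tuple_def sym_group_mult fun_eq_iff)
qed

end

theory Submission
  imports Defs
begin

text \<open>
  The elements of a section of \<open>X\<close> can be chosen outside a given set \<open>B\<close> at exactly those
  indices \<open>i\<close> with \<open>\<not> X i \<subseteq> B\<close>, independently of each other. Hence the least number of
  elements in \<open>B\<close> of a section is the number of \<open>i\<close> with \<open>X i \<subseteq> B\<close>, and the set of sections
  determines this number for every \<open>B\<close>. Moebius inversion along inclusion then recovers how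
  often each set occurs among the \<open>X i\<close>.
\<close>

lemma perm_tuple_inv_cancel:
  assumes "\<sigma> \<in> carrier (sym_group n)" "a \<in> {1..n} \<rightarrow>\<^sub>E A"
  shows "perm_tuple n (inv\<^bsub>sym_group n\<^esub> \<sigma>) (perm_tuple n \<sigma> a) = a"
proof -
  interpret group "sym_group n"
    by (rule sym_group_is_group)
  show ?thesis
    using perm_tuple_mult[OF inv_closed[OF assms(1)] assms(1), of a] perm_tuple_one[OF assms(2)]
    unfolding l_inv[OF assms(1)] by metis
qed

lemma orbit_perm_tuple_subset:
  assumes "\<sigma> \<in> carrier (sym_group n)"
  shows "orbit (sym_group n) (perm_tuple n) (perm_tuple n \<sigma> a) \<subseteq> orbit (sym_group n) (perm_tuple n) a"
proof -
  interpret group "sym_group n"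
    by (rule sym_group_is_group)
  show ?thesis
    using m_closed[OF _ assms] perm_tuple_mult[OF _ assms, of _ a, symmetric] unfolding orbit_def by blast
qed

lemma orbit_perm_tuple:
  assumes "\<sigma> \<in> carrier (sym_group n)" "a \<in> {1..n} \<rightarrow>\<^sub>E A"
  shows "orbit (sym_group n) (perm_tuple n) (perm_tuple n \<sigma> a) = orbit (sym_group n) (perm_tuple n) a"
proof -
  interpret group "sym_group n"
    by (rule sym_group_is_group)
  show ?thesis
    using orbit_perm_tuple_subset[OF assms(1), of a]
      orbit_perm_tuple_subset[OF inv_closed[OF assms(1)], of "perm_tuple n \<sigma> a"]
    by (simp add: perm_tuple_inv_cancel[OF assms])
qed

text \<open>The identity puts \<open>b\<close> in its own orbit, hence in that of \<open>a\<close>;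
  this relies on \<open>b\<close> being \<open>undefined\<close> outside the index range.\<close>

lemma orbit_perm_tuple_eqD:
  assumes "orbit (sym_group n) (perm_tuple n) a = orbit (sym_group n) (perm_tuple n) b"
    and "b \<in> {1..n} \<rightarrow>\<^sub>E A"
  obtains \<sigma> where "\<sigma> \<in> carrier (sym_group n)" "b = perm_tuple n \<sigma> a"
proof -
  interpret group "sym_group n"
    by (rule sym_group_is_group)
  have "perm_tuple n \<one>\<^bsub>sym_group n\<^esub> b \<in> orbit (sym_group n) (perm_tuple n) b"
    unfolding orbit_def by blast
  then have "b \<in> orbit (sym_group n) (perm_tuple n) a"
    using assms by (simp add: perm_tuple_one)
  then show ?thesis
    using that unfolding orbit_def by blast
qed

text \<open>\<open>inv' \<sigma>\<close> maps the indices counted on the left bijectively onto those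
  counted on the right. So the count is an invariant of the multiset, not of the chosen
  tuple.\<close>

lemma card_perm_tuple:
  assumes "\<sigma> \<in> carrier (sym_group n)"
  shows "card {i \<in> {1..n}. P (perm_tuple n \<sigma> a i)} = card {i \<in> {1..n}. P (a i)}"
proof -
  have perm: "inv' \<sigma> permutes {1..n}"
    using assms by (simp add: sym_group_carrier permutes_inv)
  have mem: "inv' \<sigma> i \<in> {1..n} \<longleftrightarrow> i \<in> {1..n}" for i
    using permutes_in_image[OF perm] .
  have "inv' \<sigma> ` {i \<in> {1..n}. P (perm_tuple n \<sigma> a i)} = {i \<in> {1..n}. P (a i)}"
  proof (intro equalityI subsetI)
    fix j assume "j \<in> {i \<in> {1..n}. P (a i)}"
    moreover obtain i where "j = inv' \<sigma> i"
      using permutes_surj[OF perm] by (metis surjD)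
    ultimately show "j \<in> inv' \<sigma> ` {i \<in> {1..n}. P (perm_tuple n \<sigma> a i)}"
      using mem by (auto simp: perm_tuple_def simp del: atLeastAtMost_iff)
  next
    fix j assume "j \<in> inv' \<sigma> ` {i \<in> {1..n}. P (perm_tuple n \<sigma> a i)}"
    then show "j \<in> {i \<in> {1..n}. P (a i)}"
      using mem by (auto simp: perm_tuple_def simp del: atLeastAtMost_iff)
  qed
  then show ?thesis
    using card_image[OF inj_on_subset[OF permutes_inj[OF perm] subset_UNIV]] by metis
qed

text \<open>A choice from \<open>X\<close>, permuted along with \<open>X\<close>, is a choice from
  the permuted family and stays in the same orbit.\<close>

lemma sections_subset_perm_tuple:
  assumes "\<sigma> \<in> carrier (sym_group n)"
  shows "sections n N X \<subseteq> sections n N (perm_tuple n \<sigma> X)"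
proof
  fix M assume "M \<in> sections n N X"
  then obtain a where M: "M \<in> n_multisets n N" "M = orbit (sym_group n) (perm_tuple n) a"
    and a: "a \<in> (\<Pi>\<^sub>E i\<in>{1..n}. X i)"
    by (auto simp: sections_def)
  have "inv' \<sigma> permutes {1..n}"
    using assms by (simp add: sym_group_carrier permutes_inv)
  then have "inv' \<sigma> i \<in> {1..n}" if "i \<in> {1..n}" for i
    using that permutes_in_image by metis
  then have "perm_tuple n \<sigma> a \<in> (\<Pi>\<^sub>E i\<in>{1..n}. perm_tuple n \<sigma> X i)"
    using a by (auto simp: perm_tuple_def PiE_def Pi_def simp del: atLeastAtMost_iff)
  \<comment> \<open>\<open>UNIV\<close> suffices: only extensionality of \<open>a\<close> matters
    here, since \<open>M\<close> is already known to be an \<open>n\<close>-multiset over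
    \<open>N\<close>.\<close>
  moreover have "a \<in> {1..n} \<rightarrow>\<^sub>E UNIV"
    using a by auto
  ultimately show "M \<in> sections n N (perm_tuple n \<sigma> X)"
    using M orbit_perm_tuple[OF assms, of a UNIV] unfolding sections_def by blast
qed

text \<open>Some section of \<open>X\<close> has an entry in \<open>B\<close> only where this is
  forced. Being also a section of \<open>Y\<close>, it has at least as many entries in
  \<open>B\<close> as \<open>Y\<close> forces.\<close>

lemma card_subset_le_of_sections_le:
  assumes X: "X \<in> nonempty_subset_tuples n N"
    and le: "sections_le n N X Y"
  shows "card {i \<in> {1..n}. Y i \<subseteq> B} \<le> card {i \<in> {1..n}. X i \<subseteq> B}"
proof -
  \<comment> \<open>Take \<open>x\<close> outside \<open>B\<close> if possible; otherwise
    \<open>X i \<subseteq> B\<close> and any element will do, one existing because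
    \<open>X i\<close> is nonempty.\<close>
  have "\<exists>x. x \<in> X i \<and> (x \<in> B \<longrightarrow> X i \<subseteq> B)" if "i \<in> {1..n}" for i
    using that X unfolding nonempty_subset_tuples_def by (auto dest!: PiE_mem)
  then obtain c where c: "c i \<in> X i" "c i \<in> B \<Longrightarrow> X i \<subseteq> B" if "i \<in> {1..n}" for i
    by metis
  define a where "a = restrict c {1..n}"
  have a: "a \<in> (\<Pi>\<^sub>E i\<in>{1..n}. X i)"
    using c by (simp add: a_def)
  then have "a \<in> {1..n} \<rightarrow>\<^sub>E N"
    using X unfolding nonempty_subset_tuples_def PiE_def Pi_def by blast
  then have "orbit (sym_group n) (perm_tuple n) a \<in> sections n N X"
    using a by (auto simp: sections_def n_multisets_def orbits_def)
  then obtain b where b: "b \<in> (\<Pi>\<^sub>E i\<in>{1..n}. Y i)"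
    and "orbit (sym_group n) (perm_tuple n) a = orbit (sym_group n) (perm_tuple n) b"
    using le by (auto simp: sections_le_def sections_def)
  moreover have "b \<in> {1..n} \<rightarrow>\<^sub>E UNIV"
    using b by auto
  ultimately obtain \<sigma> where \<sigma>: "\<sigma> \<in> carrier (sym_group n)" "b = perm_tuple n \<sigma> a"
    using orbit_perm_tuple_eqD by metis
  have "card {i \<in> {1..n}. Y i \<subseteq> B} \<le> card {i \<in> {1..n}. b i \<in> B}"
    using b by (intro card_mono) auto
  also have "\<dots> = card {i \<in> {1..n}. a i \<in> B}"
    using card_perm_tuple[OF \<sigma>(1), of "\<lambda>x. x \<in> B" a] \<sigma>(2) by simp
  also have "\<dots> \<le> card {i \<in> {1..n}. X i \<subseteq> B}"
    using c(2) by (intro card_mono) (auto simp: a_def)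
  finally show ?thesis .
qed

text \<open>This is the inversion step, done by minimal counterexample: at a minimal value with
  different fibre sizes all smaller fibres agree, and subtracting them from the equal down-set
  counts leaves equal fibres.\<close>

lemma card_fibre_eq_of_card_le_eq:
  fixes f g :: "'i \<Rightarrow> 'b::order"
  assumes fin: "finite I"
    and eq: "\<And>b. card {i \<in> I. f i \<le> b} = card {i \<in> I. g i \<le> b}"
  shows "card {i \<in> I. f i = b} = card {i \<in> I. g i = b}"
proof -
  \<comment> \<open>Fibres over values outside \<open>F\<close> are empty. Finiteness of
    \<open>F\<close> makes the sum below finite and provides a minimal value of
    disagreement.\<close>
  define F where "F = f ` I \<union> g ` I"
  have finF: "finite F"
    using fin by (simp add: F_def)
  have split: "card {i \<in> I. h i \<le> c}
      = card {i \<in> I. h i = c} + (\<Sum>d\<in>{d \<in> F. d < c}. card {i \<in> I. h i = d})"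
    if "h ` I \<subseteq> F" for h :: "'i \<Rightarrow> 'b" and c
  proof -
    have "{i \<in> I. h i \<le> c} = {i \<in> I. h i = c} \<union> (\<Union>d\<in>{d \<in> F. d < c}. {i \<in> I. h i = d})"
      using that by auto
    also have "card \<dots> = card {i \<in> I. h i = c} + card (\<Union>d\<in>{d \<in> F. d < c}. {i \<in> I. h i = d})"
      using fin finF by (intro card_Un_disjoint) auto
    also have "card (\<Union>d\<in>{d \<in> F. d < c}. {i \<in> I. h i = d})
        = (\<Sum>d\<in>{d \<in> F. d < c}. card {i \<in> I. h i = d})"
      using fin finF by (intro card_UN_disjoint) auto
    finally show ?thesis .
  qed
  show ?thesis
  proof (rule ccontr)
    let ?D = "{d \<in> F. card {i \<in> I. f i = d} \<noteq> card {i \<in> I. g i = d}}"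
    assume neq: "card {i \<in> I. f i = b} \<noteq> card {i \<in> I. g i = b}"
    have "b \<in> F"
    proof (rule ccontr)
      assume "b \<notin> F"
      then have "{i \<in> I. f i = b} = {}" "{i \<in> I. g i = b} = {}"
        by (auto simp: F_def)
      then show False
        using neq by (simp only: card.empty)
    qed
    with neq have "?D \<noteq> {}"
      by blast
    then obtain m where m: "m \<in> ?D" and min: "\<And>d. d \<in> ?D \<Longrightarrow> d \<le> m \<Longrightarrow> m = d"
      using finF finite_has_minimal[of ?D] by auto
    \<comment> \<open>A \<open>d < m\<close> with different fibre sizes would lie in
      \<open>?D\<close>, and minimality would force \<open>m = d\<close>.\<close>
    have "(\<Sum>d\<in>{d \<in> F. d < m}. card {i \<in> I. f i = d}) = (\<Sum>d\<in>{d \<in> F. d < m}. card {i \<in> I. g i = d})"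
    proof (rule sum.cong)
      fix d assume "d \<in> {d \<in> F. d < m}"
      then show "card {i \<in> I. f i = d} = card {i \<in> I. g i = d}"
        using min[of d] by force
    qed simp
    then have "card {i \<in> I. f i = m} = card {i \<in> I. g i = m}"
      using eq[of m] split[of f m] split[of g m] by (simp add: F_def)
    then show False
      using m by simp
  qed
qed

theorem proposition1:
  fixes N :: "'a set" and n :: nat and X Y :: "nat \<Rightarrow> 'a set"
  assumes "X \<in> nonempty_subset_tuples n N" and "Y \<in> nonempty_subset_tuples n N"
  shows "sections_equiv n N X Y \<longleftrightarrow> (\<exists>\<sigma> \<in> carrier (sym_group n). perm_tuple n \<sigma> X = Y)"
proof
  assume equiv: "sections_equiv n N X Y"
  have "card {i \<in> {1..n}. Y i \<le> B} = card {i \<in> {1..n}. X i \<le> B}" for B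
    using equiv card_subset_le_of_sections_le[OF assms(1)] card_subset_le_of_sections_le[OF assms(2)]
    unfolding sections_equiv_def by (intro order_antisym) blast+
  then have card_eq: "card {i \<in> {1..n}. Y i = B} = card {i \<in> {1..n}. X i = B}" for B
    by (rule card_fibre_eq_of_card_le_eq[OF finite_atLeastAtMost])
  \<comment> \<open>Fibre sizes are multiplicities, and finite families with the same multiset of
    values differ by a permutation of the indices.\<close>
  have "image_mset Y (mset_set {1..n}) = image_mset X (mset_set {1..n})"
  proof (rule multiset_eqI)
    fix B :: "'a set"
    have "count (image_mset Z (mset_set {1..n})) B = card {i \<in> {1..n}. Z i = B}"
      for Z :: "nat \<Rightarrow> 'a set"
      by (simp add: count_image_mset vimage_def Int_def conj_commute)
    then show "count (image_mset Y (mset_set {1..n})) B = count (image_mset X (mset_set {1..n})) B"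
      using card_eq by metis
  qed
  then obtain p where p: "p permutes {1..n}" "\<And>i. i \<in> {1..n} \<Longrightarrow> Y i = X (p i)"
    using image_mset_eq_implies_permutes[OF finite_atLeastAtMost] by metis
  \<comment> \<open>The action precomposes with the inverse, so \<open>Y i = X (p i)\<close> calls
    for \<open>inv' p\<close> as the witness.\<close>
  have "inv' p \<in> carrier (sym_group n)"
    using p(1) by (simp add: sym_group_carrier permutes_inv)
  moreover have "perm_tuple n (inv' p) X = Y"
  proof
    fix i
    \<comment> \<open>For \<open>i\<close> outside \<open>{1..n}\<close> both sides are
      \<open>undefined\<close>.\<close>
    show "perm_tuple n (inv' p) X i = Y i"
      unfolding perm_tuple_def permutes_inv_inv[OF p(1)]
      using p(2)[of i] PiE_arb[OF assms(2)[unfolded nonempty_subset_tuples_def], of i]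
      by (cases "i \<in> {1..n}") (simp_all only: restrict_apply if_True if_False simp_thms)
  qed
  ultimately show "\<exists>\<sigma> \<in> carrier (sym_group n). perm_tuple n \<sigma> X = Y"
    by blast
next
  interpret group "sym_group n"
    by (rule sym_group_is_group)
  assume "\<exists>\<sigma> \<in> carrier (sym_group n). perm_tuple n \<sigma> X = Y"
  then obtain \<sigma> where \<sigma>: "\<sigma> \<in> carrier (sym_group n)" "perm_tuple n \<sigma> X = Y"
    by blast
  \<comment> \<open>The inverse carries \<open>Y\<close> back to \<open>X\<close>, so the one-sided
    inclusion of sections applies in both directions.\<close>
  have "perm_tuple n (inv\<^bsub>sym_group n\<^esub> \<sigma>) Y = X"
    using \<sigma> assms(1) perm_tuple_inv_cancel unfolding nonempty_subset_tuples_def by blast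
  then show "sections_equiv n N X Y"
    using \<sigma> sections_subset_perm_tuple[OF \<sigma>(1), of N X]
      sections_subset_perm_tuple[OF inv_closed[OF \<sigma>(1)], of N Y]
    by (simp add: sections_equiv_def sections_le_def)
qed

end
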